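(* Let $A$ and $D$ be symmetric and semi-positive definite $N\times N$ matrices with constant elements, and consider the second order evolution system $$U''+\mathcal L U+AU+D\mathcal G U'=0$$ for the state variable $U=(u^{(1)},\dots,u^{(N)})^T$, with $H,V,\mathcal L,\mathcal G$ as in the context. If this system is uniformly (exponentially) stable in $(V\times H)^N$, i.e. if there exist constants $M\geqslant 1$ and $\omega>0$ such that for any given initial data $(U_0,U_1)\in (V\times H)^N$ the corresponding solution $U$ satisfies $$\|(U(t),U'(t))\|_{(V\times H)^N}\leqslant Me^{-\omega t}\|(U_0,U_1)\|_{(V\times H)^N},\quad t\geqslant 0,$$ then $\operatorname{rank}(D)=N$.
   Context: $H$ and $V$ are two separated Hilbert spaces such that $V\subset H\subset V'$, $V'$ being the dual of $V$, with dense and compact imbeddings. $L$ is the duality mapping from $V$ onto $V'$, and $g$ is a linear continuous symmetric operator from $V$ into $V'$. With $I$ the identity of $\mathbb R^N$, $\mathcal L=LI$ and $\mathcal G=gI$ are the diagonal operators acting componentwise; matrices act on the $\mathbb R^N$-index. It is taken as known that the system generates a semigroup of contractions in $(V\times H)^N$; the solution with initial data $(U_0,U_1)\in(V\times H)^N$ is the corresponding weak solution $U\in C^0(\mathbb R^+,V^N)\cap C^1(\mathbb R^+,H^N)$.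
   Formalization: V is additionally assumed infinite-dimensional: for V=H=R, L=g=1, A=((1,1),(1,1)), D=diag(1,0) the system is uniformly stable with rank(D)=1<2. The contraction property is taken in the energy norm, and the damping term is read as (DGU)'. *)

theory Defs
  imports "HOL-Analysis.Analysis"
begin

text \<open>
  \<open>V\<close> and \<open>H\<close> are real Hilbert spaces, given as types \<open>'v\<close> and \<open>'h\<close>; the inclusion of \<open>V\<close> in \<open>H\<close> is a map
  \<open>j\<close>, and \<open>V'\<close> is \<open>'v \<Rightarrow>\<^sub>L real\<close>. The inclusion of \<open>H\<close> in \<open>V'\<close> is the one with \<open>H\<close> as pivot space.
  The index set of the \<open>N\<close> components is the finite type \<open>'n\<close>, and \<open>(V \<times> H)\<^sup>N\<close> is identified
  isometrically with \<open>V\<^sup>N \<times> H\<^sup>N\<close>.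
\<close>

definition pivot :: "('v::real_inner \<Rightarrow>\<^sub>L 'h::real_inner) \<Rightarrow> 'h \<Rightarrow> ('v \<Rightarrow>\<^sub>L real)" where
  "pivot j h = blinfun_inner_right h o\<^sub>L j"

definition dense_compact_embedding ::
    "('a::real_normed_vector \<Rightarrow> 'b::real_normed_vector) \<Rightarrow> bool" where
  "dense_compact_embedding f \<longleftrightarrow>
     bounded_linear f \<and> inj f \<and> closure (range f) = UNIV \<and>
     (\<forall>B. bounded B \<longrightarrow> compact (closure (f ` B)))"

text \<open>
  Separability of \<open>V\<close> and \<open>H\<close> is a consequence of the following condition.
\<close>
definition gelfand_triple :: "('v::real_inner \<Rightarrow>\<^sub>L 'h::real_inner) \<Rightarrow> bool" where
  "gelfand_triple j \<longleftrightarrow>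
     dense_compact_embedding (blinfun_apply j) \<and> dense_compact_embedding (pivot j)"

text \<open>
  \<open>blinfun_inner_right u\<close> is the functional \<open>v \<mapsto> u \<bullet> v\<close>.
\<close>
definition duality_map :: "'v::real_inner \<Rightarrow> ('v \<Rightarrow>\<^sub>L real)" where
  "duality_map u = blinfun_inner_right u"

definition symmetric_op :: "('v::real_normed_vector \<Rightarrow>\<^sub>L 'v \<Rightarrow>\<^sub>L real) \<Rightarrow> bool" where
  "symmetric_op g \<longleftrightarrow> (\<forall>u v. g u v = g v u)"

text \<open>
  Not implied by the compact embeddings, and needed: with \<open>V = H = \<real>\<close>, \<open>L = g = 1\<close>,
  \<open>A = ((1,1),(1,1))\<close> and \<open>D = diag(1,0)\<close> the system is uniformly stable.
\<close>
definition infinite_dimensional :: "'v::real_vector itself \<Rightarrow> bool" where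
  "infinite_dimensional _ \<longleftrightarrow> \<not> (\<exists>B :: 'v set. finite B \<and> span B = UNIV)"

definition symmetric_mat :: "real^'n^'n \<Rightarrow> bool" where
  "symmetric_mat M \<longleftrightarrow> transpose M = M"

definition semi_positive_mat :: "real^'n^'n \<Rightarrow> bool" where
  "semi_positive_mat M \<longleftrightarrow> (\<forall>x. 0 \<le> x \<bullet> (M *v x))"

definition diag_op :: "('a \<Rightarrow> 'b) \<Rightarrow> 'a^'n \<Rightarrow> 'b^'n" where
  "diag_op f U = (\<chi> i. f (U $ i))"

definition mat_act :: "real^'n^'n \<Rightarrow> 'a::real_vector^'n \<Rightarrow> 'a^'n" where
  "mat_act M U = (\<chi> i. \<Sum>k\<in>UNIV. (M $ i $ k) *\<^sub>R (U $ k))"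

text \<open>
  \<open>W\<close> is the velocity \<open>U'\<close>. Since \<open>U'(t)\<close> only lies in \<open>H\<^sup>N\<close>, while \<open>g\<close> is defined on \<open>V\<close>, the term
  \<open>D\<G>U'\<close> means \<open>(D\<G>U)'\<close>: the equation is \<open>(U' + D\<G>U)' + \<L>U + AU = 0\<close> with the derivative
  taken in \<open>(V')\<^sup>N\<close>. These are exactly the mild solutions for the operator
  \<open>(U, W) \<mapsto> (W, - \<L>U - AU - D\<G>W)\<close> on the domain of all \<open>(U, W) \<in> V\<^sup>N \<times> V\<^sup>N\<close> with
  \<open>\<L>U + D\<G>W \<in> H\<^sup>N\<close>.
\<close>
definition weak_solution ::
    "('v::real_inner \<Rightarrow>\<^sub>L 'h::real_inner) \<Rightarrow> ('v \<Rightarrow>\<^sub>L 'v \<Rightarrow>\<^sub>L real) \<Rightarrow> real^'n^'n \<Rightarrow> real^'n^'n \<Rightarrow>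
     'v^'n \<Rightarrow> 'h^'n \<Rightarrow> (real \<Rightarrow> 'v^'n) \<Rightarrow> (real \<Rightarrow> 'h^'n) \<Rightarrow> bool" where
  "weak_solution j g A D U0 U1 U W \<longleftrightarrow>
     continuous_on {0..} U \<and>
     continuous_on {0..} W \<and>
     (\<forall>t\<ge>0. ((\<lambda>s. diag_op j (U s)) has_vector_derivative W t) (at t within {0..})) \<and>
     (\<forall>t\<ge>0. ((\<lambda>s. diag_op (pivot j) (W s) + mat_act D (diag_op g (U s)))
        has_vector_derivative
          - (diag_op duality_map (U t)
             + mat_act A (diag_op (pivot j) (diag_op j (U t))))) (at t within {0..})) \<and>
     U 0 = U0 \<and> W 0 = U1"

definition C0_semigroup :: "(real \<Rightarrow> 'x::real_normed_vector \<Rightarrow> 'x) \<Rightarrow> bool" where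
  "C0_semigroup S \<longleftrightarrow>
     (\<forall>t\<ge>0. bounded_linear (S t)) \<and> S 0 = id \<and>
     (\<forall>s\<ge>0. \<forall>t\<ge>0. S (s + t) = S s \<circ> S t) \<and>
     (\<forall>x. continuous_on {0..} (\<lambda>t. S t x))"

text \<open>
  The semigroup is contractive for the energy norm, a Hilbert norm equivalent to that of
  \<open>V\<^sup>N \<times> H\<^sup>N\<close> when \<open>A\<close> is semi-positive; for \<open>A \<noteq> 0\<close> it is not contractive for the product norm.
\<close>
definition energy_norm ::
    "('v::real_inner \<Rightarrow>\<^sub>L 'h::real_inner) \<Rightarrow> real^'n^'n \<Rightarrow> ('v^'n) \<times> ('h^'n) \<Rightarrow> real" where
  "energy_norm j A = (\<lambda>(U, W).
     sqrt ((norm U)\<^sup>2 + mat_act A (diag_op j U) \<bullet> diag_op j U + (norm W)\<^sup>2))"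

definition generates_contraction_semigroup ::
    "('v::real_inner \<Rightarrow>\<^sub>L 'h::real_inner) \<Rightarrow> ('v \<Rightarrow>\<^sub>L 'v \<Rightarrow>\<^sub>L real) \<Rightarrow>
     real^'n^'n \<Rightarrow> real^'n^'n \<Rightarrow> bool" where
  "generates_contraction_semigroup j g A D \<longleftrightarrow>
     (\<exists>S :: real \<Rightarrow> ('v^'n) \<times> ('h^'n) \<Rightarrow> ('v^'n) \<times> ('h^'n).
        C0_semigroup S \<and>
        (\<forall>t\<ge>0. \<forall>x. energy_norm j A (S t x) \<le> energy_norm j A x) \<and>
        (\<forall>U0 U1 U W. weak_solution j g A D U0 U1 U W \<longleftrightarrow>
           (\<forall>t\<ge>0. S t (U0, U1) = (U t, W t))))"

definition uniformly_stable ::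
    "('v::real_inner \<Rightarrow>\<^sub>L 'h::real_inner) \<Rightarrow> ('v \<Rightarrow>\<^sub>L 'v \<Rightarrow>\<^sub>L real) \<Rightarrow>
     real^'n^'n \<Rightarrow> real^'n^'n \<Rightarrow> bool" where
  "uniformly_stable j g A D \<longleftrightarrow>
     (\<exists>M\<ge>1. \<exists>\<omega>>0. \<forall>U0 U1 U W. weak_solution j g A D U0 U1 U W \<longrightarrow>
        (\<forall>t\<ge>0. norm (U t, W t) \<le> M * exp (- \<omega> * t) * norm (U0, U1)))"

end

theory Submission
  imports Defs
begin

text \<open>
  Let \<open>e\<close> be a unit vector in the kernel of \<open>D\<close>. The component \<open>u\<close> of a solution along \<open>e\<close> is not
  damped: its energy changes only through the coupling term, at the rate \<open>- 2 (e \<bullet> A U, u')\<^sub>H\<close>.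
  Start from \<open>(e \<psi>, 0)\<close> with \<open>\<psi>\<close> of norm \<open>1\<close> in \<open>V\<close> and of norm at most \<open>\<epsilon>\<close> in \<open>H\<close>; such
  \<open>\<psi>\<close> exist because \<open>V\<close> is infinite-dimensional and compactly embedded in \<open>H\<close>. The integral
  \<open>P\<close> of \<open>U\<close> is the weak solution with data \<open>(0, e \<psi>)\<close>, since \<open>D e = 0\<close>, so stability gives
  \<open>|U(t)|\<^sub>H \<le> M \<epsilon>\<close> for all \<open>t\<close>. Hence on a fixed time interval the energy of \<open>u\<close> varies by
  \<open>O(\<epsilon>)\<close>, whereas stability makes it drop from \<open>1\<close> to at most \<open>1/4\<close>.
\<close>


section \<open>Bounded componentwise and matrix operators on finite powers\<close>

lemma bounded_linear_vec_lambda: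
  fixes f :: "'n::finite \<Rightarrow> 'a::real_normed_vector \<Rightarrow> 'b::real_normed_vector"
  assumes "\<And>i. bounded_linear (f i)"
  shows "bounded_linear (\<lambda>x. \<chi> i. f i x)"
proof -
  have "norm (\<chi> i. f i x) \<le> norm x * (\<Sum>i\<in>UNIV. onorm (f i))" for x
  proof -
    have "norm (\<chi> i. f i x) \<le> (\<Sum>i\<in>UNIV. norm (f i x))"
      unfolding norm_vec_def by (rule order_trans[OF L2_set_le_sum]) auto
    also have "\<dots> \<le> (\<Sum>i\<in>UNIV. onorm (f i) * norm x)"
      by (intro sum_mono onorm assms)
    finally show ?thesis by (simp add: sum_distrib_left mult.commute)
  qed
  moreover have "linear (f i)" for i by (rule bounded_linear.linear[OF assms])
  ultimately show ?thesis
    by (intro bounded_linear_intro) (simp_all add: vec_eq_iff linear_add linear_cmul)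
qed

lemma bounded_linear_diag_op:
  "bounded_linear f \<Longrightarrow> bounded_linear (diag_op f :: 'a::real_normed_vector^'n \<Rightarrow> 'b::real_normed_vector^'n)"
  unfolding diag_op_def
  by (rule bounded_linear_vec_lambda, rule bounded_linear_compose) (auto intro: bounded_linear_vec_nth)

lemma bounded_linear_mat_act:
  "bounded_linear (mat_act M :: 'a::real_normed_vector^'n \<Rightarrow> 'a^'n)"
  unfolding mat_act_def
  by (intro bounded_linear_vec_lambda bounded_linear_sum bounded_linear_const_scaleR bounded_linear_vec_nth)

lemma bounded_linear_pivot: "bounded_linear (pivot j)"
proof -
  have "bounded_linear (\<lambda>f. f o\<^sub>L j)"
    by (rule bounded_bilinear.bounded_linear_left[OF bounded_bilinear_blinfun_compose])
  from bounded_linear_compose[OF this bounded_linear_blinfun_inner_right]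
  show ?thesis by (simp add: pivot_def[abs_def])
qed

lemma bounded_linear_duality_map: "bounded_linear duality_map"
  using bounded_linear_blinfun_inner_right by (simp add: duality_map_def[abs_def])

lemma pivot_apply: "pivot j h v = h \<bullet> j v"
  by (simp add: pivot_def)

section \<open>Components along a vector of the index space\<close>

text \<open>The contraction of \<open>U\<close> with \<open>e\<close> in the tensor product of the
  index space with \<open>'a\<close>. For a unit vector \<open>e\<close> in the kernel of a
  symmetric \<open>D\<close> it extracts the undamped component of a solution.\<close>

definition weighted_sum :: "real^'n \<Rightarrow> 'a::real_vector^'n \<Rightarrow> 'a" where
  "weighted_sum e U = (\<Sum>i\<in>UNIV. (e $ i) *\<^sub>R (U $ i))"

text \<open>The elementary tensor. On inner product spaces \<open>tensor e\<close> is adjoint to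
  \<open>weighted_sum e\<close>, and a right inverse of it when \<open>e\<close> has norm
  one.\<close>

definition tensor :: "real^'n \<Rightarrow> 'a::real_vector \<Rightarrow> 'a^'n" where
  "tensor e v = (\<chi> i. (e $ i) *\<^sub>R v)"

lemma bounded_linear_weighted_sum:
  "bounded_linear (weighted_sum e :: 'a::real_normed_vector^'n \<Rightarrow> 'a)"
  unfolding weighted_sum_def
  by (intro bounded_linear_sum bounded_linear_const_scaleR bounded_linear_vec_nth)

lemma weighted_sum_inner: "weighted_sum e U \<bullet> v = U \<bullet> tensor e v"
  by (simp add: weighted_sum_def tensor_def inner_vec_def inner_sum_left)

lemma norm_tensor: "norm (tensor e v :: 'a::real_inner^'n) = norm e * norm v"
proof -
  have "tensor e v \<bullet> tensor e v = (e \<bullet> e) * (v \<bullet> v)"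
    by (simp add: tensor_def inner_vec_def sum_distrib_right mult.assoc)
  then show ?thesis by (simp add: norm_eq_sqrt_inner real_sqrt_mult)
qed

lemma weighted_sum_tensor: "weighted_sum e (tensor e v :: 'a::real_inner^'n) = (norm e)\<^sup>2 *\<^sub>R v"
  by (simp add: weighted_sum_def tensor_def power2_norm_eq_inner inner_vec_def scaleR_left.sum)

text \<open>By adjointness the squared norm is the inner product of \<open>U\<close> with
  \<open>tensor e (weighted_sum e U)\<close>; Cauchy-Schwarz leaves one factor to cancel.\<close>

lemma norm_weighted_sum_le: "norm (weighted_sum e (U :: 'a::real_inner^'n)) \<le> norm e * norm U"
proof -
  have "(norm (weighted_sum e U))\<^sup>2 = U \<bullet> tensor e (weighted_sum e U)"
    by (simp only: power2_norm_eq_inner weighted_sum_inner)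
  also have "\<dots> \<le> norm U * (norm e * norm (weighted_sum e U))"
    using norm_cauchy_schwarz[of U "tensor e (weighted_sum e U)"] by (simp only: norm_tensor)
  finally have "norm (weighted_sum e U) * norm (weighted_sum e U) \<le> (norm e * norm U) * norm (weighted_sum e U)"
    by (simp only: power2_eq_square mult_ac)
  then show ?thesis
    by (cases "weighted_sum e U = 0") auto
qed

text \<open>This moves a matrix onto the weights, so that \<open>e v* D = 0\<close> removes the
  damping from the component along \<open>e\<close>.\<close>

lemma weighted_sum_mat_act: "weighted_sum e (mat_act M U) = weighted_sum (e v* M) U"
  by (simp add: weighted_sum_def mat_act_def vector_matrix_mult_def scaleR_sum_right scaleR_sum_left)
     (subst sum.swap, simp add: mult.commute)

lemma weighted_sum_diag_op:
  "linear f \<Longrightarrow> weighted_sum e (diag_op f U) = f (weighted_sum e U)"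
  by (simp add: weighted_sum_def diag_op_def linear_sum linear_cmul)

lemma diag_op_tensor: "linear f \<Longrightarrow> diag_op f (tensor e v) = tensor e (f v)"
  by (simp add: tensor_def diag_op_def linear_cmul)

lemma mat_act_tensor: "mat_act M (tensor e v) = tensor (M *v e) v"
  by (simp add: tensor_def mat_act_def matrix_vector_mult_def scaleR_sum_left)

section \<open>The duality isometry and antiderivatives in Hilbert spaces\<close>

lemma norm_duality_map: "norm (duality_map u) = norm u"
proof (rule antisym)
  show "norm (duality_map u) \<le> norm u"
    unfolding duality_map_def by (rule norm_blinfun_bound) (auto simp: Cauchy_Schwarz_ineq2)
  have "norm u * norm u \<le> norm (duality_map u) * norm u"
    using norm_blinfun[of "duality_map u" u]
    by (simp add: duality_map_def dot_square_norm power2_eq_square)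
  then show "norm u \<le> norm (duality_map u)"
    by (cases "u = 0") auto
qed

text \<open>An isometric image of a complete space is complete. An integral taken in the dual
  therefore stays in the range and can be pulled back.\<close>

lemma closed_range_duality_map:
  "closed (range (duality_map :: 'a::{real_inner, complete_space} \<Rightarrow> _))"
proof -
  have "complete (range (duality_map :: 'a \<Rightarrow> _))"
  proof (rule complete_isometric_image)
    show "\<forall>x\<in>UNIV. 1 * norm (x::'a) \<le> norm (duality_map x)" by (simp add: norm_duality_map)
  qed (auto simp: bounded_linear_duality_map complete_UNIV)
  then show ?thesis by (rule complete_imp_closed)
qed

text \<open>Riemann sums of \<open>f\<close> lie in \<open>S\<close> and come arbitrarily close to
  \<open>y\<close>.\<close>

lemma has_integral_in_closed_subspace:
  fixes f :: "real \<Rightarrow> 'a::real_normed_vector"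
  assumes "(f has_integral y) {a..b}" "subspace S" "closed S" "\<And>x. x \<in> {a..b} \<Longrightarrow> f x \<in> S"
  shows "y \<in> S"
proof -
  have "\<exists>z\<in>S. dist z y < e" if "e > 0" for e
  proof -
    obtain \<gamma> where \<gamma>: "gauge \<gamma>" and *: "\<And>\<D>. \<D> tagged_division_of {a..b} \<Longrightarrow> \<gamma> fine \<D> \<Longrightarrow>
        norm ((\<Sum>(x, k)\<in>\<D>. measure lborel k *\<^sub>R f x) - y) < e"
      using assms(1) \<open>e > 0\<close> unfolding has_integral_real by meson
    obtain \<D> where \<D>: "\<D> tagged_division_of {a..b}" "\<gamma> fine \<D>"
      using fine_division_exists_real[OF \<gamma>] by blast
    have "(\<Sum>(x, k)\<in>\<D>. measure lborel k *\<^sub>R f x) \<in> S"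
      using \<D>(1) assms(2,4)
      by (intro subspace_sum) (auto simp: subspace_scale dest!: tag_in_interval)
    then show ?thesis
      using *[OF \<D>] by (auto simp: dist_norm)
  qed
  then show ?thesis using \<open>closed S\<close> closed_approachable by blast
qed

text \<open>
  The library integrates only functions with values in the class \<open>banach\<close>, which is not
  implied by the sort \<open>{real_inner, complete_space}\<close>; hence the detour through the dual space.
\<close>
lemma continuous_has_antiderivative:
  fixes f :: "real \<Rightarrow> 'a::{real_inner, complete_space}"
  assumes "continuous_on {0..} f"
  obtains F where "F 0 = 0" "\<And>t. t \<ge> 0 \<Longrightarrow> (F has_vector_derivative f t) (at t within {0..})"
proof -
  define G where "G t = integral {0..t} (\<lambda>s. duality_map (f s))" for t
  have cont: "continuous_on {0..b} (\<lambda>s. duality_map (f s))" for b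
    by (intro bounded_linear.continuous_on[OF bounded_linear_duality_map]
        continuous_on_subset[OF assms]) auto
  have deriv: "(G has_vector_derivative duality_map (f t)) (at t within {0..})" if "t \<ge> 0" for t
  proof -
    have "(G has_vector_derivative duality_map (f t)) (at t within {0..t+1})"
      unfolding G_def by (rule integral_has_vector_derivative[OF cont]) (use that in auto)
    \<comment> \<open>The endpoint \<open>t+1\<close> lies strictly to the right of
      \<open>t\<close>, so truncating the half-line does not change it near
      \<open>t\<close>.\<close>
    moreover have "at t within {0..} = at t within {0..t+1}"
      by (rule at_within_nhd[of _ "{..<t+1}"]) auto
    ultimately show ?thesis by simp
  qed
  have lin: "linear (duality_map :: 'a \<Rightarrow> _)"
    by (intro bounded_linear.linear bounded_linear_duality_map)
  have sub: "subspace (range (duality_map :: 'a \<Rightarrow> _))"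
    by (rule linear_subspace_image[OF lin subspace_UNIV])
  have "G t \<in> range duality_map" for t
    unfolding G_def
    by (rule has_integral_in_closed_subspace[OF integrable_integral
          [OF integrable_continuous_real[OF cont]] sub closed_range_duality_map]) simp
  then have "\<forall>t. \<exists>x. duality_map x = G t" by (metis imageE)
  then obtain F where F: "\<And>t. duality_map (F t) = G t" by metis
  show thesis
  proof
    have "duality_map (F 0) = 0" by (simp add: F G_def)
    then show "F 0 = 0" by (metis norm_duality_map norm_eq_zero)
  next
    fix t :: real assume t: "t \<ge> 0"
    \<comment> \<open>The isometry gives the first-order remainders of \<open>F\<close> and
      \<open>G\<close> equal norms, so differentiability transfers back to \<open>F\<close>.\<close>
    have "duality_map (F s - F t - (s - t) *\<^sub>R f t) = G s - G t - (s - t) *\<^sub>R duality_map (f t)" for s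
      by (simp only: linear_diff[OF lin] linear_cmul[OF lin] F)
    then have "norm (F s - F t - (s - t) *\<^sub>R f t) = norm (G s - G t - (s - t) *\<^sub>R duality_map (f t))" for s
      by (metis norm_duality_map)
    then show "(F has_vector_derivative f t) (at t within {0..})"
      using deriv[OF t] unfolding has_vector_derivative_def has_derivative_within_alt
      by (simp add: bounded_linear_scaleR_left)
  qed
qed

section \<open>Unit vectors with small image under a compact embedding\<close>

text \<open>One Gram-Schmidt step: a vector outside the finite-dimensional span of \<open>B\<close>
  has a nonzero residual after projection, which is then normalised.\<close>

lemma orthonormal_extend:
  fixes B :: "'v::real_inner set"
  assumes "infinite_dimensional TYPE('v)" and "finite B"
    and orth: "\<And>a b. a \<in> B \<Longrightarrow> b \<in> B \<Longrightarrow> a \<bullet> b = (if a = b then 1 else 0)"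
  obtains x where "norm x = 1" "\<And>b. b \<in> B \<Longrightarrow> b \<bullet> x = 0"
proof -
  obtain v where v: "v \<notin> span B"
    using assms(1,2) unfolding infinite_dimensional_def by auto
  define w where "w = v - (\<Sum>b\<in>B. (b \<bullet> v) *\<^sub>R b)"
  have "w \<noteq> 0"
  proof
    assume "w = 0"
    then have "v = (\<Sum>b\<in>B. (b \<bullet> v) *\<^sub>R b)" by (simp add: w_def)
    also have "\<dots> \<in> span B" by (intro span_sum span_scale span_base)
    finally show False using v by simp
  qed
  have "b \<bullet> w = 0" if "b \<in> B" for b
  proof -
    have "b \<bullet> w = b \<bullet> v - (\<Sum>a\<in>B. (a \<bullet> v) * (b \<bullet> a))"
      by (simp add: w_def inner_diff_right inner_sum_right)
    also have "(\<Sum>a\<in>B. (a \<bullet> v) * (b \<bullet> a)) = (\<Sum>a\<in>B. if b = a then b \<bullet> v else 0)"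
      by (intro sum.cong) (auto simp: orth that)
    finally show ?thesis using that \<open>finite B\<close> by simp
  qed
  then show thesis
    using \<open>w \<noteq> 0\<close> by (intro that[of "sgn w"]) (auto simp: norm_sgn sgn_div_norm)
qed

lemma orthonormal_sequence:
  assumes "infinite_dimensional TYPE('v::real_inner)"
  obtains x :: "nat \<Rightarrow> 'v::real_inner" where "\<And>m n. x m \<bullet> x n = (if m = n then 1 else 0)"
proof -
  have "\<exists>x::nat \<Rightarrow> 'v. \<forall>n. norm (x n) = 1 \<and> (\<forall>m<n. x m \<bullet> x n = 0)"
  proof (rule dependent_wellorder_choice[where P = "\<lambda>x n y. norm y = 1 \<and> (\<forall>m<n. x m \<bullet> y = 0)"])
    fix n and x :: "nat \<Rightarrow> 'v"
    assume IH: "\<And>m. m < n \<Longrightarrow> norm (x m) = 1 \<and> (\<forall>k<m. x k \<bullet> x m = 0)"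
    have "a \<bullet> b = (if a = b then 1 else 0)" if "a \<in> x ` {..<n}" "b \<in> x ` {..<n}" for a b
    proof -
      obtain k l where kl: "a = x k" "b = x l" "k < n" "l < n" using \<open>a \<in> _\<close> \<open>b \<in> _\<close> by auto
      show ?thesis
        using IH[of k] IH[of l] kl
        by (cases k l rule: linorder_cases)
          (auto simp: inner_commute norm_eq_1)
    qed
    then obtain y where "norm y = 1" "\<And>b. b \<in> x ` {..<n} \<Longrightarrow> b \<bullet> y = 0"
      using orthonormal_extend[OF assms, of "x ` {..<n}"] by blast
    then show "\<exists>y. norm y = 1 \<and> (\<forall>m<n. x m \<bullet> y = 0)" by auto
  qed auto
  then obtain x :: "nat \<Rightarrow> 'v" where x: "\<And>n. norm (x n) = 1" "\<And>m n. m < n \<Longrightarrow> x m \<bullet> x n = 0"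
    by blast
  have "x m \<bullet> x n = (if m = n then 1 else 0)" for m n
    using x(1)[of n] x(2)[of m n] x(2)[of n m]
    by (cases m n rule: linorder_cases) (auto simp: inner_commute norm_eq_1)
  then show thesis by (rule that)
qed

text \<open>Orthonormal vectors stay at mutual distance \<open>sqrt 2\<close>, while their images
  have a Cauchy subsequence. The normalised difference of two late terms is the required
  vector.\<close>

lemma compact_map_small_unit_vector:
  fixes f :: "'v::real_inner \<Rightarrow> 'b::real_normed_vector"
  assumes "infinite_dimensional TYPE('v)" and f: "dense_compact_embedding f" and "\<epsilon> > 0"
  obtains \<psi> where "norm \<psi> = 1" "norm (f \<psi>) < \<epsilon>"
proof -
  interpret bounded_linear f using f by (simp add: dense_compact_embedding_def)
  obtain x :: "nat \<Rightarrow> 'v" where x: "\<And>m n. x m \<bullet> x n = (if m = n then 1 else 0)"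
    using orthonormal_sequence[OF assms(1)] by blast
  have "norm (x n) = 1" for n by (simp add: norm_eq_1 x)
  then have "bounded (range x)" by (intro boundedI[of _ 1]) auto
  then have "compact (closure (f ` range x))"
    using f by (simp add: dense_compact_embedding_def)
  moreover have "\<forall>n. (f \<circ> x) n \<in> closure (f ` range x)"
    using closure_subset[of "f ` range x"] by auto
  ultimately obtain l r where "strict_mono r" and "(f \<circ> x \<circ> r) \<longlonglongrightarrow> l"
    unfolding compact_def by blast
  then have "Cauchy (f \<circ> x \<circ> r)" by (intro LIMSEQ_imp_Cauchy)
  then obtain N where N: "\<And>m n. m \<ge> N \<Longrightarrow> n \<ge> N \<Longrightarrow> dist (f (x (r m))) (f (x (r n))) < \<epsilon>"
    using \<open>\<epsilon> > 0\<close> unfolding Cauchy_def by (metis comp_apply)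
  define y where "y = x (r N) - x (r (Suc N))"
  have "r N \<noteq> r (Suc N)" using \<open>strict_mono r\<close> by (metis n_not_Suc_n strict_mono_eq)
  then have "y \<bullet> y = 2"
    by (simp add: y_def inner_diff_left inner_diff_right x)
  then have y: "norm y = sqrt 2" by (simp add: norm_eq_sqrt_inner)
  have "norm (f y) < \<epsilon>" using N[of N "Suc N"] by (simp add: y_def diff dist_norm)
  moreover have "norm (f (y /\<^sub>R sqrt 2)) \<le> norm (f y)"
    using mult_right_mono[of "inverse (sqrt 2)" 1 "norm (f y)"]
    by (simp add: scaleR inverse_le_1_iff)
  ultimately show thesis
    using y by (intro that[of "y /\<^sub>R sqrt 2"]) auto
qed


section \<open>Integrating a weak solution in time\<close>

lemma has_vector_derivative_vec_lambda:
  fixes f :: "'n::finite \<Rightarrow> real \<Rightarrow> 'a::real_normed_vector"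
  assumes "\<And>i. (f i has_vector_derivative f' i) F"
  shows "((\<lambda>t. \<chi> i. f i t) has_vector_derivative (\<chi> i. f' i)) F"
proof -
  have bl: "bounded_linear (axis i :: 'a \<Rightarrow> 'a^'n)" for i
  proof -
    have "bounded_linear (\<lambda>x::'a. if k = i then x else 0)" for k
      by (cases "k = i") (simp_all add: bounded_linear_ident bounded_linear_zero)
    then show ?thesis unfolding axis_def by (rule bounded_linear_vec_lambda)
  qed
  have eq: "(\<chi> i. x i) = (\<Sum>i\<in>UNIV. axis i (x i))" for x :: "'n \<Rightarrow> 'a"
    by (simp add: vec_eq_iff axis_def if_distrib cong: if_cong)
  show ?thesis
    unfolding eq by (intro has_vector_derivative_sum bounded_linear.has_vector_derivative[OF bl] assms)
qed

text \<open>Integrating the equation once shows that the antiderivative of \<open>U\<close> solves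
  the same system with velocity \<open>diag_op j U\<close>. Stability applied to it controls
  \<open>U\<close> in \<open>H\<close> by weaker data.\<close>

lemma weak_solution_integral:
  fixes j :: "'v::{real_inner, complete_space} \<Rightarrow>\<^sub>L 'h::real_inner"
    and U :: "real \<Rightarrow> 'v^'n"
  assumes sol: "weak_solution j g A D U0 0 U W"
    and compat: "mat_act D (diag_op g U0) = 0"
  obtains P where
    "\<And>t. t \<ge> 0 \<Longrightarrow> (P has_vector_derivative U t) (at t within {0..})"
    "\<And>t. t \<ge> 0 \<Longrightarrow> diag_op (pivot j) (W t) + mat_act D (diag_op g (U t)) =
        - (diag_op duality_map (P t) + mat_act A (diag_op (pivot j) (diag_op j (P t))))"
    "weak_solution j g A D 0 (diag_op j U0) P (\<lambda>t. diag_op j (U t))"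
proof -
  note bl = bounded_linear.has_vector_derivative[OF bounded_linear_diag_op[OF blinfun.bounded_linear_right]]
    bounded_linear.has_vector_derivative[OF bounded_linear_diag_op[OF bounded_linear_pivot]]
    bounded_linear.has_vector_derivative[OF bounded_linear_diag_op[OF bounded_linear_duality_map]]
    bounded_linear.has_vector_derivative[OF bounded_linear_mat_act]
  have contU: "continuous_on {0..} U"
    and dU: "\<And>t. t \<ge> 0 \<Longrightarrow> ((\<lambda>s. diag_op j (U s)) has_vector_derivative W t) (at t within {0..})"
    and dW: "\<And>t. t \<ge> 0 \<Longrightarrow> ((\<lambda>s. diag_op (pivot j) (W s) + mat_act D (diag_op g (U s)))
        has_vector_derivative
          - (diag_op duality_map (U t)
             + mat_act A (diag_op (pivot j) (diag_op j (U t))))) (at t within {0..})"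
    and init: "U 0 = U0" "W 0 = 0"
    using sol by (auto simp: weak_solution_def)
  have "\<exists>F. F 0 = 0 \<and> (\<forall>t\<ge>0. (F has_vector_derivative U t $ i) (at t within {0..}))" for i
  proof -
    have "continuous_on {0..} (\<lambda>t. U t $ i)"
      by (rule bounded_linear.continuous_on[OF bounded_linear_vec_nth contU])
    then show ?thesis by (rule continuous_has_antiderivative) blast
  qed
  then obtain F where F0: "\<And>i. F i 0 = 0"
    and F: "\<And>i t. t \<ge> 0 \<Longrightarrow> (F i has_vector_derivative U t $ i) (at t within {0..})"
    by metis
  define P where "P t = (\<chi> i. F i t)" for t
  have P0: "P 0 = 0" by (simp add: P_def F0 vec_eq_iff)
  have dP: "(P has_vector_derivative U t) (at t within {0..})" if "t \<ge> 0" for t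
    using has_vector_derivative_vec_lambda[of F "\<lambda>i. U t $ i", OF F[OF that]]
    by (simp add: P_def[abs_def])
  \<comment> \<open>The defect of the integrated equation; its derivative cancels by the equation
    for \<open>U\<close>.\<close>
  define R where "R t = diag_op (pivot j) (W t) + mat_act D (diag_op g (U t)) +
     (diag_op duality_map (P t) + mat_act A (diag_op (pivot j) (diag_op j (P t))))" for t
  have "(R has_vector_derivative 0) (at t within {0..})" if "t \<in> {0..}" for t
  proof -
    have t: "t \<ge> 0" using that by simp
    have "(R has_vector_derivative
        - (diag_op duality_map (U t) + mat_act A (diag_op (pivot j) (diag_op j (U t)))) +
        (diag_op duality_map (U t) + mat_act A (diag_op (pivot j) (diag_op j (U t))))) (at t within {0..})"
      unfolding R_def by (intro has_vector_derivative_add dW t bl dP)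
    then show ?thesis by simp
  qed
  then obtain c where c: "\<And>t. t \<in> {0..} \<Longrightarrow> R t = c"
    using has_vector_derivative_zero_constant[of "{0..}" R] by auto
  have lin: "diag_op (pivot j) (0::'h^'n) = 0" "diag_op duality_map (0::'v^'n) = 0"
     "diag_op j (0::'v^'n) = 0" "mat_act A (0::('v \<Rightarrow>\<^sub>L real)^'n) = 0"
    by (simp_all only: linear_0 bounded_linear.linear bounded_linear_diag_op bounded_linear_mat_act
        bounded_linear_pivot bounded_linear_duality_map blinfun.bounded_linear_right)
  \<comment> \<open>The constant of integration vanishes because of the zero initial velocity and
    \<open>compat\<close>.\<close>
  have "R 0 = 0" by (simp add: R_def init P0 lin compat)
  then have eq: "diag_op (pivot j) (W t) + mat_act D (diag_op g (U t)) =
        - (diag_op duality_map (P t) + mat_act A (diag_op (pivot j) (diag_op j (P t))))"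
    if "t \<ge> 0" for t
  proof -
    have "R t = 0" using c[of 0] c[of t] that \<open>R 0 = 0\<close> by simp
    then show ?thesis by (simp only: R_def eq_neg_iff_add_eq_0)
  qed
  have "weak_solution j g A D 0 (diag_op j U0) P (\<lambda>t. diag_op j (U t))"
    unfolding weak_solution_def
  proof (intro conjI allI impI)
    show "continuous_on {0..} P"
      by (rule continuous_on_vector_derivative) (use dP in auto)
    show "continuous_on {0..} (\<lambda>t. diag_op j (U t))"
      by (rule continuous_on_vector_derivative) (use dU in auto)
    show "P 0 = 0" "diag_op j (U 0) = diag_op j U0" by (simp_all add: P0 init)
  next
    fix t :: real assume t: "t \<ge> 0"
    show "((\<lambda>s. diag_op j (P s)) has_vector_derivative diag_op j (U t)) (at t within {0..})"
      by (intro bl dP t)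
    \<comment> \<open>Differentiation gives
      \<open>diag_op (pivot j) (W t) + mat_act D (diag_op g (U t))\<close>, and the integrated
      equation is read backwards.\<close>
    show "((\<lambda>s. diag_op (pivot j) (diag_op j (U s)) + mat_act D (diag_op g (P s)))
        has_vector_derivative
          - (diag_op duality_map (P t)
             + mat_act A (diag_op (pivot j) (diag_op j (P t))))) (at t within {0..})"
      unfolding eq[OF t, symmetric] by (intro has_vector_derivative_add bl dP dU t)
  qed
  with dP eq show thesis by (rule that)
qed

section \<open>Difference quotients and the energy of one component\<close>

lemma norm_increment_le:
  fixes f :: "real \<Rightarrow> 'a::real_normed_vector"
  assumes "\<And>t. t \<ge> 0 \<Longrightarrow> (f has_vector_derivative f' t) (at t within {0..})"
    and "\<And>t. t \<ge> 0 \<Longrightarrow> norm (f' t) \<le> K" and "s \<ge> 0" "h \<ge> 0"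
  shows "norm (f (s + h) - f s) \<le> K * h"
proof -
  have "norm (f (s + h) - f s) \<le> K * norm (s + h - s)"
    by (rule differentiable_bound[of "{0..}" _ "\<lambda>t h. h *\<^sub>R f' t"])
      (use assms in \<open>auto simp: has_vector_derivative_def mult.commute[of K] intro!: onorm_le mult_left_mono\<close>)
  then show ?thesis using assms by simp
qed

lemma has_vector_derivative_shift_within:
  fixes f :: "real \<Rightarrow> 'a::real_normed_vector"
  assumes "(f has_vector_derivative f') (at (t + h) within {0..})" and "h \<ge> 0"
  shows "((\<lambda>s. f (s + h)) has_vector_derivative f') (at t within {0..})"
proof -
  have "(f \<circ> (\<lambda>s. s + h) has_vector_derivative 1 *\<^sub>R f') (at t within {0..})"
  proof (rule vector_diff_chain_within)
    show "((\<lambda>s. s + h) has_vector_derivative 1) (at t within {0..})"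
      by (auto intro!: derivative_eq_intros)
    show "(f has_vector_derivative f') (at (t + h) within (\<lambda>s. s + h) ` {0..})"
      by (rule has_vector_derivative_within_subset[OF assms(1)]) (use \<open>h \<ge> 0\<close> in auto)
  qed
  then show ?thesis by (simp add: o_def)
qed

text \<open>Taking only \<open>h > 0\<close> keeps \<open>t + h\<close> in the half-line, so
  \<open>t = 0\<close> is covered too.\<close>

lemma has_vector_derivative_right_quotient:
  fixes f :: "real \<Rightarrow> 'a::real_normed_vector"
  assumes "(f has_vector_derivative f') (at t within {0..})" and "t \<ge> 0"
  shows "((\<lambda>h. (f (t + h) - f t) /\<^sub>R h) \<longlongrightarrow> f') (at_right 0)"
proof -
  have lim: "((\<lambda>y. (1 / norm (y - t)) *\<^sub>R (f y - (f t + (y - t) *\<^sub>R f'))) \<longlongrightarrow> 0) (at t within {0..})"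
    using assms(1) by (simp add: has_vector_derivative_def has_derivative_within)
  have "filterlim (\<lambda>h. t + h) (at t within {0..}) (at_right 0)"
    unfolding filterlim_at using \<open>t \<ge> 0\<close>
    by (auto intro!: tendsto_eq_intros simp: eventually_at_filter)
  from filterlim_compose[OF lim this]
  have "((\<lambda>h. (1 / norm h) *\<^sub>R (f (t + h) - (f t + h *\<^sub>R f'))) \<longlongrightarrow> 0) (at_right 0)"
    by simp
  then have "((\<lambda>h. (f (t + h) - f t) /\<^sub>R h - f') \<longlongrightarrow> 0) (at_right 0)"
    by (rule Lim_transform_eventually)
      (auto simp: eventually_at_filter algebra_simps divide_inverse)
  then show ?thesis using Lim_null by blast
qed

text \<open>
  \<open>w\<close> lies in \<open>H\<close> only, so it cannot be used as a test vector; the difference quotients of \<open>u\<close>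
  lie in \<open>V\<close>, and the energy identity for them passes to the limit.
\<close>
lemma energy_increment_le:
  fixes j :: "'v::real_inner \<Rightarrow>\<^sub>L 'h::real_inner"
  assumes dp: "\<And>t. t \<ge> 0 \<Longrightarrow> (p has_vector_derivative u t) (at t within {0..})"
    and du: "\<And>t. t \<ge> 0 \<Longrightarrow> ((\<lambda>s. j (u s)) has_vector_derivative w t) (at t within {0..})"
    and dz: "\<And>t. t \<ge> 0 \<Longrightarrow> (z has_vector_derivative z' t) (at t within {0..})"
    and eq: "\<And>t v. t \<ge> 0 \<Longrightarrow> w t \<bullet> j v + p t \<bullet> v + z t \<bullet> j v = 0"
    and w: "\<And>t. t \<ge> 0 \<Longrightarrow> norm (w t) \<le> C"
    and z': "\<And>t. t \<ge> 0 \<Longrightarrow> norm (z' t) \<le> K"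
    and "T \<ge> 0"
  shows "\<bar>(norm (u T))\<^sup>2 + (norm (w T))\<^sup>2 - ((norm (u 0))\<^sup>2 + (norm (w 0))\<^sup>2)\<bar> \<le> 2 * K * C * T"
proof -
  \<comment> \<open>The energy of the difference quotients: those of \<open>p\<close> tend to
    \<open>u\<close> in \<open>V\<close>, and those of \<open>j u\<close> tend to \<open>w\<close>
    in \<open>H\<close>.\<close>
  define E where "E h t = (norm ((p (t + h) - p t) /\<^sub>R h))\<^sup>2 + (norm ((j (u (t + h)) - j (u t)) /\<^sub>R h))\<^sup>2"
    for h t
  have lim: "((\<lambda>h. E h t) \<longlongrightarrow> (norm (u t))\<^sup>2 + (norm (w t))\<^sup>2) (at_right 0)" if "t \<ge> 0" for t
    unfolding E_def
    by (intro tendsto_intros has_vector_derivative_right_quotient dp du that)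
  have bound: "\<bar>E h T - E h 0\<bar> \<le> 2 * K * C * T" if "h > 0" for h
  proof -
    define q where "q f t = (f (t + h) - f t) /\<^sub>R h" for f :: "real \<Rightarrow> 'h" and t
    define qu where "qu t = (u (t + h) - u t) /\<^sub>R h" for t
    define E' where "E' t = - 2 * (q z t \<bullet> j (qu t))" for t
    have jqu: "j (qu t) = q (\<lambda>s. j (u s)) t" for t
      by (simp add: q_def qu_def blinfun.scaleR_right blinfun.diff_right)
    have dE: "(E h has_vector_derivative E' t) (at t within {0..})" if "t \<ge> 0" for t
    proof -
      have 1: "((\<lambda>s. (p (s + h) - p s) /\<^sub>R h) has_vector_derivative qu t) (at t within {0..})"
        unfolding qu_def
        by (intro bounded_linear.has_vector_derivative[OF bounded_linear_scaleR_right]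
            has_vector_derivative_diff has_vector_derivative_shift_within dp)
          (use that \<open>h > 0\<close> in auto)
      have 2: "((\<lambda>s. (j (u (s + h)) - j (u s)) /\<^sub>R h) has_vector_derivative q w t) (at t within {0..})"
        unfolding q_def
        by (intro bounded_linear.has_vector_derivative[OF bounded_linear_scaleR_right]
            has_vector_derivative_diff has_vector_derivative_shift_within[of "\<lambda>s. j (u s)"] du)
          (use that \<open>h > 0\<close> in auto)
      \<comment> \<open>The equation tested with the fixed vector \<open>qu t\<close>; it vanishes
        at \<open>t\<close> and \<open>t + h\<close>, hence so does its difference quotient.\<close>
      let ?r = "\<lambda>s. w s \<bullet> j (qu t) + p s \<bullet> qu t + z s \<bullet> j (qu t)"
      have "q w t \<bullet> j (qu t) + ((p (t + h) - p t) /\<^sub>R h) \<bullet> qu t + q z t \<bullet> j (qu t) =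
          inverse h * (?r (t + h) - ?r t)"
        by (simp add: q_def inner_diff_left algebra_simps)
      then have weak: "q w t \<bullet> j (qu t) + ((p (t + h) - p t) /\<^sub>R h) \<bullet> qu t + q z t \<bullet> j (qu t) = 0"
        using that \<open>h > 0\<close> by (simp add: eq)
      show ?thesis
        unfolding E_def power2_norm_eq_inner
        by (rule has_vector_derivative_eq_rhs[OF has_vector_derivative_add[OF
              bounded_bilinear.has_vector_derivative[OF bounded_bilinear_inner 1 1]
              bounded_bilinear.has_vector_derivative[OF bounded_bilinear_inner 2 2]]])
          (use weak in \<open>simp add: E'_def jqu q_def inner_commute algebra_simps\<close>)
    qed
    have quot: "norm (y /\<^sub>R h) \<le> B" if "norm y \<le> B * h" for y :: 'h and B
      using that \<open>h > 0\<close> by (simp add: pos_divide_le_eq flip: divide_inverse_commute)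
    \<comment> \<open>The mean value inequality bounds the quotients of \<open>z\<close> by
      \<open>K\<close> and those of \<open>j u\<close> by \<open>C\<close>, uniformly in
      \<open>h\<close>, so the estimate survives the limit.\<close>
    have "norm (E' t) \<le> 2 * K * C" if "t \<ge> 0" for t
    proof -
      have 1: "norm (q z t) \<le> K"
        using norm_increment_le[OF dz z', of t h] that \<open>h > 0\<close>
        unfolding q_def by (intro quot) simp
      have 2: "norm (j (qu t)) \<le> C"
        using norm_increment_le[OF du w, of t h] that \<open>h > 0\<close>
        unfolding jqu q_def by (intro quot) simp
      have "\<bar>q z t \<bullet> j (qu t)\<bar> \<le> norm (q z t) * norm (j (qu t))"
        by (rule Cauchy_Schwarz_ineq2)
      also have "\<dots> \<le> K * C"
        using 1 2 by (intro mult_mono) (auto intro: order_trans[OF norm_ge_zero])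
      finally show ?thesis by (simp add: E'_def abs_mult)
    qed
    from norm_increment_le[OF dE this, of 0 T] show ?thesis using \<open>T \<ge> 0\<close> by simp
  qed
  show ?thesis
  proof (rule tendsto_upperbound)
    show "((\<lambda>h. \<bar>E h T - E h 0\<bar>) \<longlongrightarrow>
      \<bar>(norm (u T))\<^sup>2 + (norm (w T))\<^sup>2 - ((norm (u 0))\<^sup>2 + (norm (w 0))\<^sup>2)\<bar>) (at_right 0)"
      by (intro tendsto_intros lim \<open>T \<ge> 0\<close> order_refl)
    show "\<forall>\<^sub>F h in at_right 0. \<bar>E h T - E h 0\<bar> \<le> 2 * K * C * T"
      using bound by (auto simp: eventually_at_filter)
  qed simp
qed

section \<open>Energy of the undamped component and the contradiction\<close>

theorem corollary2p5:
  fixes j :: "'v::{real_inner, complete_space} \<Rightarrow>\<^sub>L 'h::{real_inner, complete_space}"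
    and g :: "'v \<Rightarrow>\<^sub>L 'v \<Rightarrow>\<^sub>L real"
    and A D :: "real^'n^'n"
  assumes "gelfand_triple j"
    and "infinite_dimensional TYPE('v)"
    and "symmetric_op g"
    and "symmetric_mat A" and "semi_positive_mat A"
    and "symmetric_mat D" and "semi_positive_mat D"
    and "generates_contraction_semigroup j g A D"
    and "uniformly_stable j g A D"
  shows "rank D = CARD('n)"
proof (rule ccontr)
  assume "rank D \<noteq> CARD('n)"
  then obtain x where "x \<noteq> 0" "D *v x = 0"
    by (auto simp: full_rank_injective vec.inj_iff_eq_0)
  define e where "e = sgn x"
  have e: "norm e = 1" "D *v e = 0"
    using \<open>x \<noteq> 0\<close> \<open>D *v x = 0\<close>
    by (auto simp: e_def norm_sgn sgn_div_norm matrix_vector_mult_scaleR)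
  \<comment> \<open>Symmetry turns the right kernel vector into a left one, as needed to contract
    the equation with \<open>e\<close>.\<close>
  have eD: "e v* D = 0"
    using e(2) \<open>symmetric_mat D\<close> by (metis symmetric_mat_def transpose_matrix_vector)
  \<comment> \<open>The row through which the zeroth-order term couples the component along
    \<open>e\<close> to all components.\<close>
  define a where "a = e v* A"
  obtain M \<omega> where M: "M \<ge> 1" "\<omega> > 0"
    and stable: "\<And>U0 U1 U W t. weak_solution j g A D U0 U1 U W \<Longrightarrow> t \<ge> 0 \<Longrightarrow>
        norm (U t, W t) \<le> M * exp (- \<omega> * t) * norm (U0, U1)"
    using \<open>uniformly_stable j g A D\<close> unfolding uniformly_stable_def by metis
  \<comment> \<open>Stability only estimates given solutions; the semigroup supplies them.\<close>
  have exists: "\<exists>U W. weak_solution j g A D U0 U1 U W" for U0 U1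
  proof -
    obtain S where S: "\<And>U0 U1 U W. weak_solution j g A D U0 U1 U W \<longleftrightarrow>
           (\<forall>t\<ge>0. S t (U0, U1) = (U t, W t))"
      using \<open>generates_contraction_semigroup j g A D\<close>
      unfolding generates_contraction_semigroup_def by metis
    have "weak_solution j g A D U0 U1 (\<lambda>t. fst (S t (U0, U1))) (\<lambda>t. snd (S t (U0, U1)))"
      by (simp add: S)
    then show ?thesis by blast
  qed
  have bounded: "norm (U t) \<le> M * norm (U0, U1)" "norm (W t) \<le> M * norm (U0, U1)"
    if "weak_solution j g A D U0 U1 U W" "t \<ge> 0" for U0 U1 U W t
  proof -
    have "M * exp (- \<omega> * t) * norm (U0, U1) \<le> M * 1 * norm (U0, U1)"
      using M \<open>t \<ge> 0\<close> by (intro mult_mono) auto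
    with stable[OF that] show "norm (U t) \<le> M * norm (U0, U1)" "norm (W t) \<le> M * norm (U0, U1)"
      using norm_fst_le[of "U t" "W t"] norm_snd_le[of "W t" "U t"] by auto
  qed
  \<comment> \<open>The time at which the decay factor equals 1/2; it is nonnegative since
    \<open>M\<close> is at least one.\<close>
  define T where "T = ln (2 * M) / \<omega>"
  have T: "T \<ge> 0" "M * exp (- \<omega> * T) = 1 / 2"
    using M by (auto simp: T_def exp_minus field_simps)
  \<comment> \<open>With \<open>c = norm a * M * M * T\<close> the energy increment will be at most
    \<open>2 * c / (1 + 4 * c)\<close>, which is below 1/2 for every
    \<open>c \<ge> 0\<close>.\<close>
  define \<epsilon> where "\<epsilon> = 1 / (1 + 4 * (norm a * M * M * T))"
  have pos: "norm a * M * M * T \<ge> 0" using M T by simp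
  then have "\<epsilon> > 0" by (auto simp: \<epsilon>_def)
  then obtain \<psi> :: 'v where \<psi>: "norm \<psi> = 1" "norm (j \<psi>) < \<epsilon>"
    using compact_map_small_unit_vector[OF \<open>infinite_dimensional TYPE('v)\<close>, of "blinfun_apply j"]
      \<open>gelfand_triple j\<close> unfolding gelfand_triple_def by blast
  obtain U W where sol: "weak_solution j g A D (tensor e \<psi>) 0 U W" using exists by blast
  have init: "U 0 = tensor e \<psi>" "W 0 = 0" using sol by (auto simp: weak_solution_def)
  have lin: "linear j" "linear g" "linear (pivot j)" "linear (duality_map :: 'v \<Rightarrow> _)"
    by (auto intro: bounded_linear.linear bounded_linear_pivot bounded_linear_duality_map
        blinfun.bounded_linear_right)
  \<comment> \<open>The compatibility condition for integrating: \<open>D\<close> annihilates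
    \<open>e\<close>.\<close>
  have "mat_act D (diag_op g (tensor e \<psi>)) = 0"
    by (simp add: diag_op_tensor lin mat_act_tensor e) (simp add: tensor_def vec_eq_iff)
  from sol this obtain P where
    dP: "\<And>t. t \<ge> 0 \<Longrightarrow> (P has_vector_derivative U t) (at t within {0..})"
    and eq: "\<And>t. t \<ge> 0 \<Longrightarrow> diag_op (pivot j) (W t) + mat_act D (diag_op g (U t)) =
        - (diag_op duality_map (P t) + mat_act A (diag_op (pivot j) (diag_op j (P t))))"
    and "weak_solution j g A D 0 (diag_op j (tensor e \<psi>)) P (\<lambda>t. diag_op j (U t))"
    by (rule weak_solution_integral) (rule that; assumption)
  then have solP: "weak_solution j g A D 0 (tensor e (j \<psi>)) P (\<lambda>t. diag_op j (U t))"
    by (simp only: diag_op_tensor lin)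
  note ws = bounded_linear.has_vector_derivative[OF bounded_linear_weighted_sum]
  have add: "weighted_sum e (X + Y) = weighted_sum e X + weighted_sum e Y"
    "weighted_sum e (- X) = - weighted_sum e X" for X Y :: "('v \<Rightarrow>\<^sub>L real)^'n"
    by (auto intro: linear_add linear_neg bounded_linear.linear[OF bounded_linear_weighted_sum])
  have zero: "weighted_sum 0 X = 0" for X :: "('v \<Rightarrow>\<^sub>L real)^'n" by (simp add: weighted_sum_def)
  let ?u = "\<lambda>t. weighted_sum e (U t)" and ?w = "\<lambda>t. weighted_sum e (W t)"
  have "\<bar>(norm (?u T))\<^sup>2 + (norm (?w T))\<^sup>2 - ((norm (?u 0))\<^sup>2 + (norm (?w 0))\<^sup>2)\<bar>
      \<le> 2 * (norm a * (M * \<epsilon>)) * M * T"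
  proof (rule energy_increment_le[where j = j])
    fix t :: real assume t: "t \<ge> 0"
    show "((\<lambda>s. weighted_sum e (P s)) has_vector_derivative ?u t) (at t within {0..})"
      by (intro ws dP t)
    have "((\<lambda>s. diag_op j (U s)) has_vector_derivative W t) (at t within {0..})"
      using sol t by (simp add: weak_solution_def)
    from ws[OF this, of e]
    show "((\<lambda>s. j (?u s)) has_vector_derivative ?w t) (at t within {0..})"
      by (simp add: weighted_sum_diag_op lin)
    show "((\<lambda>s. weighted_sum a (diag_op j (P s))) has_vector_derivative weighted_sum a (diag_op j (U t)))
        (at t within {0..})"
      by (intro ws bounded_linear.has_vector_derivative[OF bounded_linear_diag_op]
          blinfun.bounded_linear_right dP t)
    \<comment> \<open>Contracting the integrated equation with \<open>e\<close> removes the damping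
      by \<open>eD\<close> and turns \<open>A\<close> into the weights \<open>a\<close>.\<close>
    show "?w t \<bullet> j v + weighted_sum e (P t) \<bullet> v + weighted_sum a (diag_op j (P t)) \<bullet> j v = 0" for v
    proof -
      have "pivot j (?w t) =
          - (duality_map (weighted_sum e (P t)) + pivot j (weighted_sum a (diag_op j (P t))))"
        using arg_cong[OF eq[OF t], of "weighted_sum e"]
        by (simp only: add weighted_sum_mat_act weighted_sum_diag_op lin eD a_def zero add_0_right)
      from arg_cong[OF this, of "\<lambda>f. blinfun_apply f v"] show ?thesis
        by (simp add: pivot_apply duality_map_def blinfun.minus_left blinfun.add_left blinfun.diff_left)
    qed
    show "norm (?w t) \<le> M"
      using norm_weighted_sum_le[of e "W t"] bounded(2)[OF sol t] e \<psi>
      by (simp add: norm_tensor)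
    \<comment> \<open>The decisive gain: \<open>diag_op j (U t)\<close> is the velocity of
      \<open>P\<close>, whose data have norm \<open>norm (j \<psi>)\<close> rather than one.\<close>
    have "norm (diag_op j (U t)) \<le> M * norm (j \<psi>)"
      using bounded(2)[OF solP t] e by (simp add: norm_tensor)
    also have "\<dots> \<le> M * \<epsilon>" using \<psi> M by simp
    finally show "norm (weighted_sum a (diag_op j (U t))) \<le> norm a * (M * \<epsilon>)"
      using norm_weighted_sum_le[of a "diag_op j (U t)"]
      by (meson mult_left_mono norm_ge_zero order_trans)
  qed (fact T(1))
  moreover have "(norm (?u 0))\<^sup>2 + (norm (?w 0))\<^sup>2 = 1"
    using \<psi> e norm_weighted_sum_le[of e "0::'h^'n"] by (simp add: init weighted_sum_tensor)
  moreover have "(norm (?u T))\<^sup>2 + (norm (?w T))\<^sup>2 \<le> 1 / 4"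
  proof -
    have "(norm (?u T))\<^sup>2 + (norm (?w T))\<^sup>2 \<le> (norm (U T))\<^sup>2 + (norm (W T))\<^sup>2"
      using norm_weighted_sum_le[of e "U T"] norm_weighted_sum_le[of e "W T"] e
      by (intro add_mono power_mono) auto
    also have "\<dots> = (norm (U T, W T))\<^sup>2" by (simp add: norm_Pair)
    also have "\<dots> \<le> (1 / 2)\<^sup>2"
      using stable[OF sol T(1)] T(2) e \<psi> by (intro power_mono) (auto simp: norm_tensor)
    finally show ?thesis by (simp add: power2_eq_square)
  qed
  moreover have "2 * (norm a * (M * \<epsilon>)) * M * T \<le> 1 / 2"
  proof -
    have "2 * (norm a * (M * \<epsilon>)) * M * T = 2 * (norm a * M * M * T) / (1 + 4 * (norm a * M * M * T))"
      by (simp add: \<epsilon>_def)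
    also have "\<dots> \<le> 1 / 2" using pos by (simp add: divide_le_eq)
    finally show ?thesis .
  qed
  \<comment> \<open>The energy falls from 1 to at most 1/4, although it can change by at most
    1/2.\<close>
  ultimately show False by linarith
qed

end
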